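(* Let $\mathcal{H}\subseteq\wp(\mathbb{N})$ be a coideal. The following are equivalent: (1) $\mathcal{H}$ is semiselective. (2) For every $\mathcal{X}\subseteq\mathbb{N}^{[\infty]}$: $\mathcal{X}$ is $\mathcal{H}$-Ramsey if and only if for every $A\in\mathcal{H}$ and every $a\in\mathbb{N}^{[<\infty]}$ the game $G_{\mathcal{H}}(a,A,\mathcal{X})$ is determined.
   Context: $\mathbb{N}=\{0,1,2,\dots\}$. For $A\subseteq\mathbb{N}$, $A^{[\infty]}$ (resp. $A^{[<\infty]}$) is the set of infinite (resp. finite) subsets of $A$. For finite $a$ and $A\subseteq\mathbb{N}$, $A/a=\{n\in A: n>\max(a)\}$ and $A/n=A/\{n\}$; $a\sqsubset B$ means $a$ is an initial segment of $B$; $[a,A]=\{B\in\mathbb{N}^{[\infty]}: a\sqsubset B\subseteq A\}$. A coideal is a family $\mathcal{H}\subseteq\wp(\mathbb{N})$, $\mathcal{H}\neq\wp(\mathbb{N})$, such that $A\subseteq B$, $A\in\mathcal{H}$ imply $B\in\mathcal{H}$, and $A\cup B\in\mathcal{H}$ implies $A\in\mathcal{H}$ or $B\in\mathcal{H}$. Write $\mathcal{H}\upharpoonright A=\{B\in\mathcal{H}: B\subseteq A\}$. A set $D\subseteq\mathcal{H}$ is dense open in $(\mathcal{H},\subseteq)$ if every $A\in\mathcal{H}$ has a subset in $D$ and $D$ is closed under taking subsets belonging to $\mathcal{H}$. Given a sequence $(D_n)_{n\in\mathbb{N}}$ of dense open subsets of $(\mathcal{H},\subseteq)$, $B$ is a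 diagonalization of it if $B/n\in D_n$ for every $n\in B$. $\mathcal{H}$ is semiselective if for every such sequence $(D_n)_n$ and every $A\in\mathcal{H}$ there is a diagonalization $B\in\mathcal{H}$ of $(D_n)_n$ with $B\subseteq A$. $\mathcal{X}\subseteq\mathbb{N}^{[\infty]}$ is $\mathcal{H}$-Ramsey if for every $a\in\mathbb{N}^{[<\infty]}$ and $A\in\mathcal{H}$ with $[a,A]\neq\emptyset$ there is $B\in[a,A]\cap\mathcal{H}$ with $[a,B]\subseteq\mathcal{X}$ or $[a,B]\cap\mathcal{X}=\emptyset$. The game $G_{\mathcal{H}}(a,A,\mathcal{X})$ (for $A\in\mathcal{H}$, $a\in\mathbb{N}^{[<\infty]}$, $\mathcal{X}\subseteq\mathbb{N}^{[\infty]}$): player I plays $A_0\in\mathcal{H}\upharpoonright A$; II answers with $n_0\in A_0$ with $a\subseteq n_0$ (i.e. all elements of $a$ are $<n_0$) and $B_0\in\mathcal{H}\cap(A_0/n_0)^{[\infty]}$; I plays $A_1\in\mathcal{H}\cap B_0^{[\infty]}$; II answers $n_1\in A_1$ and $B_1\in\mathcal{H}\cap(A_1/n_1)^{[\infty]}$; and so on. Player I wins iff $a\cup\{n_j:j\in\mathbb{N}\}\in\mathcal{X}$. The game is determined if one of the players has a winning strategy.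
   Formalization: The coideal is also assumed to have only infinite members; otherwise II may have no legal move in the game, and the equivalence fails, e.g. for the family of all sets that are infinite or contain 0. *)

theory Defs
  imports Main
begin

definition coideal :: "nat set set \<Rightarrow> bool" where
  "coideal H \<longleftrightarrow>
     H \<noteq> UNIV \<and>
     (\<forall>A B. A \<in> H \<and> A \<subseteq> B \<longrightarrow> B \<in> H) \<and>
     (\<forall>A B. A \<union> B \<in> H \<longrightarrow> A \<in> H \<or> B \<in> H)"

(* A/n *)
definition above :: "nat set \<Rightarrow> nat \<Rightarrow> nat set" where
  "above A n = {m \<in> A. n < m}"

definition init_segment :: "nat set \<Rightarrow> nat set \<Rightarrow> bool" where
  "init_segment a B \<longleftrightarrow> a \<subseteq> B \<and> (\<forall>x\<in>a. \<forall>y\<in>B. y \<le> x \<longrightarrow> y \<in> a)"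

(* [a,A] *)
definition basic_set :: "nat set \<Rightarrow> nat set \<Rightarrow> nat set set" where
  "basic_set a A = {B. infinite B \<and> init_segment a B \<and> B \<subseteq> A}"

definition dense_open :: "nat set set \<Rightarrow> nat set set \<Rightarrow> bool" where
  "dense_open H D \<longleftrightarrow>
     D \<subseteq> H \<and>
     (\<forall>A\<in>H. \<exists>B\<in>D. B \<subseteq> A) \<and>
     (\<forall>A\<in>D. \<forall>B\<in>H. B \<subseteq> A \<longrightarrow> B \<in> D)"

definition diagonalization :: "(nat \<Rightarrow> nat set set) \<Rightarrow> nat set \<Rightarrow> bool" where
  "diagonalization D B \<longleftrightarrow> (\<forall>n\<in>B. above B n \<in> D n)"

definition semiselective :: "nat set set \<Rightarrow> bool" where
  "semiselective H \<longleftrightarrow>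
     (\<forall>D. (\<forall>n. dense_open H (D n)) \<longrightarrow>
        (\<forall>A\<in>H. \<exists>B\<in>H. B \<subseteq> A \<and> diagonalization D B))"

definition ramsey_for :: "nat set set \<Rightarrow> nat set set \<Rightarrow> bool" where
  "ramsey_for H X \<longleftrightarrow>
     (\<forall>a A. finite a \<and> A \<in> H \<and> basic_set a A \<noteq> {} \<longrightarrow>
        (\<exists>B \<in> basic_set a A \<inter> H. basic_set a B \<subseteq> X \<or> basic_set a B \<inter> X = {}))"

(* A run of the game is As 0, (ns 0, Bs 0), As 1, (ns 1, Bs 1), ...  The two
   predicates below say that the k-th move of I, respectively of II, obeys the
   rules, given the moves before it. *)

definition legal_I ::
  "nat set set \<Rightarrow> nat set \<Rightarrow> (nat \<Rightarrow> nat set) \<Rightarrow> (nat \<Rightarrow> nat set) \<Rightarrow> nat \<Rightarrow> bool" where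
  "legal_I H A As Bs k \<longleftrightarrow>
     As k \<in> H \<and>
     (case k of 0 \<Rightarrow> As 0 \<subseteq> A | Suc j \<Rightarrow> infinite (As k) \<and> As k \<subseteq> Bs j)"

definition legal_II ::
  "nat set set \<Rightarrow> nat set \<Rightarrow> (nat \<Rightarrow> nat set) \<Rightarrow> (nat \<Rightarrow> nat) \<Rightarrow> (nat \<Rightarrow> nat set) \<Rightarrow> nat \<Rightarrow> bool" where
  "legal_II H a As ns Bs k \<longleftrightarrow>
     ns k \<in> As k \<and> (k = 0 \<longrightarrow> (\<forall>x\<in>a. x < ns 0)) \<and>
     Bs k \<in> H \<and> infinite (Bs k) \<and> Bs k \<subseteq> above (As k) (ns k)"

(* A strategy maps the list of all previous moves of the opponent to the next
   move.  A winning strategy prescribes a legal move as long as the opponent has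
   played legally, and wins every infinite run in which the opponent plays
   legally throughout. *)

definition winning_strategy_I ::
  "nat set set \<Rightarrow> nat set \<Rightarrow> nat set \<Rightarrow> nat set set \<Rightarrow> ((nat \<times> nat set) list \<Rightarrow> nat set) \<Rightarrow> bool" where
  "winning_strategy_I H a A X \<sigma> \<longleftrightarrow>
     (\<forall>ns Bs.
        let As = (\<lambda>k. \<sigma> (map (\<lambda>i. (ns i, Bs i)) [0..<k])) in
          (\<forall>k. (\<forall>j<k. legal_II H a As ns Bs j) \<longrightarrow> legal_I H A As Bs k) \<and>
          ((\<forall>k. legal_II H a As ns Bs k) \<longrightarrow> a \<union> range ns \<in> X))"

definition winning_strategy_II ::
  "nat set set \<Rightarrow> nat set \<Rightarrow> nat set \<Rightarrow> nat set set \<Rightarrow> (nat set list \<Rightarrow> nat \<times> nat set) \<Rightarrow> bool" where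
  "winning_strategy_II H a A X \<tau> \<longleftrightarrow>
     (\<forall>As.
        let ns = (\<lambda>k. fst (\<tau> (map As [0..<Suc k])));
            Bs = (\<lambda>k. snd (\<tau> (map As [0..<Suc k]))) in
          (\<forall>k. (\<forall>j\<le>k. legal_I H A As Bs j) \<longrightarrow> legal_II H a As ns Bs k) \<and>
          ((\<forall>k. legal_I H A As Bs k) \<longrightarrow> a \<union> range ns \<notin> X))"

definition determined :: "nat set set \<Rightarrow> nat set \<Rightarrow> nat set \<Rightarrow> nat set set \<Rightarrow> bool" where
  "determined H a A X \<longleftrightarrow>
     (\<exists>\<sigma>. winning_strategy_I H a A X \<sigma>) \<or> (\<exists>\<tau>. winning_strategy_II H a A X \<tau>)"

end

theory Submission
  imports Defs "HOL-Library.Infinite_Set"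
begin

text \<open>If I wins the game, a diagonalization in \<open>H\<close> of suitable dense open sets yields \<open>E \<in> H\<close>
  all of whose infinite subsets arise as the numbers played in a run following the strategy, so
  that \<open>E\<close> is homogeneous. If II wins, the sets \<open>E\<close> such that every \<open>n \<in> E\<close> is II's
  answer to some move, with an answer set containing \<open>E/n\<close>, are dense; this reverses the roles of
  the players and the same fusion applies. Conversely, for any coideal a homogeneous set gives a
  winning strategy at once. If determinacy implies the Ramsey property, apply this to the set of
  diagonalizations of a sequence: I wins its game below every element of \<open>H\<close>, so no homogeneous
  set can avoid it.\<close>

section \<open>Dense open sets and maximal antichains\<close>

lemma dense_openI:
  assumes "D \<subseteq> H" "\<And>A. A \<in> H \<Longrightarrow> \<exists>B\<in>D. B \<subseteq> A"
    and "\<And>A B. A \<in> D \<Longrightarrow> B \<in> H \<Longrightarrow> B \<subseteq> A \<Longrightarrow> B \<in> D"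
  shows "dense_open H D"
  using assms by (simp add: dense_open_def)

lemma dense_openD:
  assumes "dense_open H D"
  shows "D \<subseteq> H" "A \<in> H \<Longrightarrow> \<exists>B\<in>D. B \<subseteq> A"
    and "A \<in> D \<Longrightarrow> B \<in> H \<Longrightarrow> B \<subseteq> A \<Longrightarrow> B \<in> D"
  using assms by (auto simp: dense_open_def)

text \<open>By Zorn's lemma, because the union of a chain of antichains is an antichain. The
  antichain consists of states rather than of their sets, so that a set in \<open>H\<close> can lie
  below at most one member of it.\<close>

lemma ex_maximal_antichain:
  fixes M :: "'p \<Rightarrow> nat set"
  shows "\<exists>V\<subseteq>W. pairwise (\<lambda>q r. M q \<inter> M r \<notin> H) V \<and> (\<forall>q\<in>W. M q \<in> H \<longrightarrow> (\<exists>r\<in>V. M q \<inter> M r \<in> H))"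
proof -
  define R where "R = (\<lambda>q r. M q \<inter> M r \<notin> H)"
  define C where "C = {V. V \<subseteq> W \<and> pairwise R V}"
  have "\<exists>V\<in>C. \<forall>X\<in>C. V \<subseteq> X \<longrightarrow> X = V"
  proof (rule subset_Zorn_nonempty)
    have "{} \<in> C" by (simp add: C_def)
    then show "C \<noteq> {}" by blast
  next
    fix K assume "K \<noteq> {}" and K: "subset.chain C K"
    then have "K \<subseteq> C" and "chain\<^sub>\<subseteq> K"
      by (auto simp: subset.chain_def chain_subset_def)
    then show "\<Union>K \<in> C"
      using pairwise_chain_Union[of K R] by (auto simp: C_def)
  qed
  then obtain V where "V \<in> C" and "\<forall>X\<in>C. V \<subseteq> X \<longrightarrow> X = V" ..
  then have V: "V \<subseteq> W" "pairwise R V"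
    and max: "\<And>X. X \<subseteq> W \<Longrightarrow> pairwise R X \<Longrightarrow> V \<subseteq> X \<Longrightarrow> X = V"
    by (simp_all add: C_def)
  have "\<exists>r\<in>V. M q \<inter> M r \<in> H" if q: "q \<in> W" "M q \<in> H" for q
  proof (rule ccontr)
    assume no: "\<not> ?thesis"
    then have "pairwise R (insert q V)"
      using V(2) by (auto simp: pairwise_insert R_def Int_commute)
    then have "q \<in> V"
      using max[of "insert q V"] q V(1) by blast
    \<comment> \<open>Now \<open>q\<close> is its own witness, since
      \<open>M q \<inter> M q = M q\<close>.\<close>
    with no q show False by auto
  qed
  with V show ?thesis unfolding R_def by blast
qed

section \<open>Deciding and fusing the branches of a tree of states\<close>

text \<open>The second alternative keeps these sets dense whatever \<open>V\<close> is; where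
  successors exist, \<open>fusion\<close> rules it out by maximality of the antichain.\<close>

definition decides :: "nat set set \<Rightarrow> ('p \<Rightarrow> nat set) \<Rightarrow> 'p set \<Rightarrow> nat set set" where
  "decides H M V = {C \<in> H. (\<exists>q\<in>V. C \<subseteq> M q) \<or> (\<forall>q\<in>V. C \<inter> M q \<notin> H)}"

text \<open>For a set in \<open>H\<close> and antichains \<open>V p n\<close>, at most one
  \<open>q\<close> qualifies at each letter. So this follows a single path of states along the word
  and asks nothing more once the path stops.\<close>

primrec decided ::
  "nat set set \<Rightarrow> ('p \<Rightarrow> nat set) \<Rightarrow> ('p \<Rightarrow> nat \<Rightarrow> 'p set) \<Rightarrow> nat set \<Rightarrow> 'p \<Rightarrow> nat list \<Rightarrow> bool" where
  "decided H M V C p [] \<longleftrightarrow> True"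
| "decided H M V C p (n # s) \<longleftrightarrow>
     C \<in> decides H M (V p n) \<and> (\<forall>q\<in>V p n. C \<subseteq> M q \<longrightarrow> decided H M V C q s)"

text \<open>Since all members are infinite, finite sets are negligible: removing finitely many
  points, in particular passing to a tail, does not lead out of \<open>H\<close>.\<close>

locale infinitary_coideal =
  fixes H :: "nat set set"
  assumes coideal: "coideal H"
    and infinite_mem: "A \<in> H \<Longrightarrow> infinite A"
begin

lemma upward: "A \<in> H \<Longrightarrow> A \<subseteq> B \<Longrightarrow> B \<in> H"
  using coideal unfolding coideal_def by blast

lemma Un_mem: "A \<union> B \<in> H \<Longrightarrow> A \<in> H \<or> B \<in> H"
  using coideal unfolding coideal_def by blast

lemma Diff_finite_mem:
  assumes "A \<in> H" "finite F"
  shows "A - F \<in> H"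
  using Un_mem[of "A - F" "A \<inter> F"] assms infinite_mem[of "A \<inter> F"]
  by (auto simp: Un_Diff_Int)

lemma above_mem:
  assumes "A \<in> H"
  shows "above A n \<in> H"
proof -
  have "above A n = A - {..n}" by (auto simp: above_def)
  then show ?thesis using Diff_finite_mem[OF assms, of "{..n}"] by simp
qed

text \<open>Induction on \<open>I\<close>, shrinking once for each index. The factor
  \<open>H\<close> makes the empty intersection \<open>H\<close> itself instead of
  \<open>UNIV\<close>.\<close>

lemma dense_open_Inter:
  assumes "finite I" "\<And>i. i \<in> I \<Longrightarrow> dense_open H (D i)"
  shows "dense_open H (H \<inter> (\<Inter>i\<in>I. D i))"
  using assms
proof (induction I rule: finite_induct)
  case empty
  then show ?case by (auto simp: dense_open_def)
next
  case (insert j I)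
  then have D: "dense_open H (D j)" and I: "dense_open H (H \<inter> (\<Inter>i\<in>I. D i))" by auto
  have 1: "\<exists>B\<in>H \<inter> (\<Inter>i\<in>insert j I. D i). B \<subseteq> A" if A: "A \<in> H" for A
  proof -
    obtain B where B: "B \<in> H \<inter> (\<Inter>i\<in>I. D i)" "B \<subseteq> A"
      using dense_openD(2)[OF I A] by blast
    obtain C where C: "C \<in> D j" "C \<subseteq> B"
      using dense_openD(2)[OF D, of B] B by blast
    have "C \<in> H" using dense_openD(1)[OF D] C by blast
    then have "C \<in> H \<inter> (\<Inter>i\<in>I. D i)"
      using dense_openD(3)[OF I B(1)] C by blast
    then have "C \<in> H \<inter> (\<Inter>i\<in>insert j I. D i)" using C(1) by simp
    then show ?thesis using B(2) C(2) by (meson order_trans)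
  qed
  have 2: "B \<in> H \<inter> (\<Inter>i\<in>insert j I. D i)"
    if "A \<in> H \<inter> (\<Inter>i\<in>insert j I. D i)" "B \<in> H" "B \<subseteq> A" for A B
  proof -
    have "B \<in> D j" using dense_openD(3)[OF D _ that(2,3)] that(1) by blast
    moreover have "B \<in> H \<inter> (\<Inter>i\<in>I. D i)"
      using dense_openD(3)[OF I _ that(2,3)] that(1) by blast
    ultimately show ?thesis by simp
  qed
  show ?case by (rule dense_openI[OF _ 1 2]) simp_all
qed

text \<open>A set in \<open>H\<close> below two states puts the intersection of their sets into
  \<open>H\<close>.\<close>

lemma antichain_unique:
  assumes "pairwise (\<lambda>q r. M q \<inter> M r \<notin> H) V" "C \<in> H" "q \<in> V" "r \<in> V" "C \<subseteq> M q" "C \<subseteq> M r"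
  shows "q = r"
  using assms upward[of C "M q \<inter> M r"] unfolding pairwise_def by blast

lemma decides_mono: "C \<in> decides H M V \<Longrightarrow> C' \<in> H \<Longrightarrow> C' \<subseteq> C \<Longrightarrow> C' \<in> decides H M V"
  unfolding decides_def using upward[of "C' \<inter> M _" "C \<inter> M _"] by blast

lemma decides_dense:
  assumes "A \<in> H"
  shows "\<exists>C\<in>decides H M V. C \<subseteq> A"
proof (cases "\<exists>q\<in>V. A \<inter> M q \<in> H")
  case True
  then obtain q where "q \<in> V" "A \<inter> M q \<in> H" by blast
  then have "A \<inter> M q \<in> decides H M V" unfolding decides_def by blast
  then show ?thesis by blast
next
  case False
  with assms have "A \<in> decides H M V" unfolding decides_def by blast
  then show ?thesis by blast
qed

text \<open>Shrinking \<open>C\<close> could create a new inclusion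
  \<open>C' \<subseteq> M q\<close>. But then \<open>C \<inter> M q\<close> is in \<open>H\<close>,
  so \<open>C\<close> was already below a member of the antichain, and uniqueness makes that member
  \<open>q\<close>.\<close>

lemma decided_mono:
  assumes "\<And>p n. pairwise (\<lambda>q r. M q \<inter> M r \<notin> H) (V p n)"
    and "decided H M V C p s" "C' \<in> H" "C' \<subseteq> C"
  shows "decided H M V C' p s"
  using assms(2)
proof (induction s arbitrary: p)
  case Nil
  then show ?case by simp
next
  case (Cons n s)
  have C: "C \<in> decides H M (V p n)" using Cons.prems by simp
  have "decided H M V C' q s" if q: "q \<in> V p n" "C' \<subseteq> M q" for q
  proof -
    have "C \<inter> M q \<in> H" using upward[OF assms(3), of "C \<inter> M q"] q assms(4) by blast
    then obtain r where r: "r \<in> V p n" "C \<subseteq> M r"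
      using C q unfolding decides_def by blast
    then have "r = q"
      using antichain_unique[OF assms(1) assms(3) r(1) q(1)] assms(4) q by blast
    then show ?thesis using Cons r by simp
  qed
  then show ?case using decides_mono[OF C assms(3,4)] by simp
qed

text \<open>Induction on the word with one shrinking per letter. As at most one successor contains
  the set, the induction hypothesis has to be applied to one state only.\<close>

lemma decided_dense:
  assumes anti: "\<And>p n. pairwise (\<lambda>q r. M q \<inter> M r \<notin> H) (V p n)"
    and "A \<in> H"
  shows "\<exists>C\<in>H. C \<subseteq> A \<and> decided H M V C p s"
  using assms(2)
proof (induction s arbitrary: p A)
  case Nil
  then show ?case by auto
next
  case (Cons n s)
  obtain C where C: "C \<in> decides H M (V p n)" "C \<subseteq> A"
    using decides_dense[OF Cons.prems] by blast
  then have CH: "C \<in> H" by (simp add: decides_def)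
  show ?case
  proof (cases "\<exists>q\<in>V p n. C \<subseteq> M q")
    case True
    then obtain q where q: "q \<in> V p n" "C \<subseteq> M q" by blast
    obtain C' where C': "C' \<in> H" "C' \<subseteq> C" "decided H M V C' q s"
      using Cons.IH[OF CH] by blast
    have "decided H M V C' r s" if "r \<in> V p n" "C' \<subseteq> M r" for r
      using antichain_unique[OF anti C'(1) q(1) that(1)] that C' q by blast
    then have "decided H M V C' p (n # s)"
      using decides_mono[OF C(1) C'(1,2)] by simp
    then show ?thesis using C' C by blast
  next
    case False
    then have "decided H M V C p (n # s)" using C by auto
    then show ?thesis using C CH by blast
  qed
qed

text \<open>Restricting the successors of every state to a maximal antichain makes the state reached
  along a finite sequence depend only on that sequence, once the remaining set has decided it.
  This is what lets a single diagonalization serve all the branches simultaneously.\<close>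

lemma fusion:
  fixes M :: "'p \<Rightarrow> nat set"
  assumes semi: "semiselective H"
    and p0: "p0 \<in> L"
    and M: "\<And>p. p \<in> L \<Longrightarrow> M p \<in> H"
    and W: "\<And>p n q. p \<in> L \<Longrightarrow> q \<in> W p n \<Longrightarrow> q \<in> L"
    and dense: "\<And>p n B. p \<in> L \<Longrightarrow> n \<in> M p \<Longrightarrow> B \<in> H \<Longrightarrow> B \<subseteq> above (M p) n \<Longrightarrow> \<exists>q\<in>W p n. M q \<subseteq> B"
  obtains E where "E \<in> H" "E \<subseteq> M p0"
    and "\<And>S. infinite S \<Longrightarrow> S \<subseteq> E \<Longrightarrow>
           \<exists>p s. p 0 = p0 \<and> range s = S \<and> (\<forall>i. p (Suc i) \<in> W (p i) (s i))"
proof -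
  define P where "P p n X \<longleftrightarrow> X \<subseteq> W p n \<and> pairwise (\<lambda>q r. M q \<inter> M r \<notin> H) X \<and>
      (\<forall>q\<in>W p n. M q \<in> H \<longrightarrow> (\<exists>r\<in>X. M q \<inter> M r \<in> H))" for p n X
  define V where "V p n = (SOME X. P p n X)" for p n
  have "P p n (V p n)" for p n
    unfolding V_def by (rule someI_ex) (use ex_maximal_antichain[of "W p n" M H] in \<open>auto simp: P_def\<close>)
  then have VW: "\<And>p n. V p n \<subseteq> W p n"
    and anti: "\<And>p n. pairwise (\<lambda>q r. M q \<inter> M r \<notin> H) (V p n)"
    and maximal: "\<And>p n q. q \<in> W p n \<Longrightarrow> M q \<in> H \<Longrightarrow> \<exists>r\<in>V p n. M q \<inter> M r \<in> H"
    unfolding P_def by blast+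
  \<comment> \<open>There are finitely many such words for each \<open>n\<close>. A strictly
    increasing word with last letter \<open>n\<close> is among them, having at most
    \<open>Suc n\<close> letters, all in \<open>{..n}\<close>.\<close>
  define T where "T n = {s. set s \<subseteq> {..n} \<and> length s \<le> Suc n}" for n :: nat
  define D where "D n = H \<inter> (\<Inter>s\<in>T n. {C \<in> H. decided H M V C p0 s})" for n
  have "dense_open H (D n)" for n
    unfolding D_def
  proof (rule dense_open_Inter)
    show "finite (T n)" unfolding T_def by (rule finite_lists_length_le) simp
    show "dense_open H {C \<in> H. decided H M V C p0 s}" for s
    proof (rule dense_openI)
      show "\<exists>B\<in>{C \<in> H. decided H M V C p0 s}. B \<subseteq> A" if "A \<in> H" for A
        using decided_dense[of M V A p0 s, OF anti that] by auto
      show "B \<in> {C \<in> H. decided H M V C p0 s}"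
        if "A \<in> {C \<in> H. decided H M V C p0 s}" "B \<in> H" "B \<subseteq> A" for A B
        using decided_mono[of M V A p0 s B, OF anti] that by simp
    qed simp
  qed
  then obtain E where E: "E \<in> H" "E \<subseteq> M p0" and diag: "diagonalization D E"
    using semi M[OF p0] unfolding semiselective_def by blast
  have "\<exists>p s. p 0 = p0 \<and> range s = S \<and> (\<forall>i. p (Suc i) \<in> W (p i) (s i))"
    if S: "infinite S" "S \<subseteq> E" for S
  proof -
    define s where "s = enumerate S"
    have range: "range s = S" unfolding s_def by (rule range_enumerate[OF S(1)])
    then have sE: "s i \<in> E" for i using S by blast
    have mono: "i < j \<Longrightarrow> s i < s j" for i j
      unfolding s_def using S(1) by simp
    then have mono_le: "i \<le> j \<Longrightarrow> s i \<le> s j" for i j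
      by (metis le_eq_less_or_eq)
    have self: "j \<le> s j" for j unfolding s_def using le_enumerate[OF S(1)] .
    have start: "decided H M V (above E (s j)) p0 (map s [0..<Suc j])" for j
    proof -
      have "map s [0..<Suc j] \<in> T (s j)"
        using mono_le self[of j] by (auto simp: T_def)
      then show ?thesis
        using diag sE[of j] unfolding diagonalization_def D_def by blast
    qed
    \<comment> \<open>\<open>p\<close> is the state reached after \<open>i\<close> letters: all
      later tails of \<open>E\<close> lie below it and have decided the rest of \<open>S\<close>
      from it. The clause for \<open>i = 0\<close> carries the starting state through
      \<open>dependent_nat_choice\<close>.\<close>
    define Inv where "Inv i p \<longleftrightarrow> p \<in> L \<and> (i = 0 \<longrightarrow> p = p0) \<and>
        (\<forall>j\<ge>i. s j \<in> M p \<and> above E (s j) \<subseteq> M p \<and>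
               decided H M V (above E (s j)) p (map s [i..<Suc j]))" for i p
    have "\<exists>p. \<forall>i. Inv i (p i) \<and> p (Suc i) \<in> W (p i) (s i)"
    proof (rule dependent_nat_choice)
      have "Inv 0 p0"
        unfolding Inv_def using start E(2) sE p0 by (auto simp: above_def)
      then show "\<exists>p. Inv 0 p" ..
    next
      fix p i assume Inv: "Inv i p"
      let ?C = "above E (s i)"
      have pL: "p \<in> L" and si: "s i \<in> M p" and CM: "?C \<subseteq> M p"
        and dec: "decided H M V ?C p [s i]"
        using Inv unfolding Inv_def by auto
      have CH: "?C \<in> H" using above_mem[OF E(1)] .
      have "?C \<subseteq> above (M p) (s i)" using CM by (auto simp: above_def)
      then obtain q where q: "q \<in> W p (s i)" "M q \<subseteq> ?C"
        using dense[OF pL si CH] by blast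
      \<comment> \<open>The successor \<open>q\<close> need not belong to the antichain. Maximality
        gives a member compatible with \<open>q\<close>; this excludes the negative alternative of
        \<open>decides\<close>, so the tail \<open>?C\<close> lies below some member.\<close>
      then obtain r where "r \<in> V p (s i)" "M q \<inter> M r \<in> H"
        using maximal M[OF W[OF pL q(1)]] by blast
      moreover have "?C \<inter> M r \<in> H" using upward[OF calculation(2)] q by blast
      ultimately obtain r where r: "r \<in> V p (s i)" "?C \<subseteq> M r"
        using dec by (auto simp: decides_def)
      have "s j \<in> M r \<and> above E (s j) \<subseteq> M r \<and>
            decided H M V (above E (s j)) r (map s [Suc i..<Suc j])" if j: "Suc i \<le> j" for j
      proof -
        have lt: "s i < s j" using mono j by simp
        then have sub: "above E (s j) \<subseteq> M r" and "s j \<in> M r"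
          using r(2) sE[of j] by (auto simp: above_def subset_iff)
        \<comment> \<open>As this tail lies in \<open>M r\<close>, reading off the first letter
          leaves the remaining word decided from \<open>r\<close>.\<close>
        have "decided H M V (above E (s j)) p (s i # map s [Suc i..<Suc j])"
        proof -
          have "i < Suc j" using j by simp
          then have "map s [i..<Suc j] = s i # map s [Suc i..<Suc j]"
            by (simp only: upt_conv_Cons list.map)
          moreover have "decided H M V (above E (s j)) p (map s [i..<Suc j])"
            using Inv j unfolding Inv_def by (simp del: upt_Suc)
          ultimately show ?thesis by (simp only:)
        qed
        then show ?thesis using r sub \<open>s j \<in> M r\<close> by auto
      qed
      then have "Inv (Suc i) r"
        unfolding Inv_def using W[OF pL] r VW by blast
      then show "\<exists>q. Inv (Suc i) q \<and> q \<in> W p (s i)" using r VW by blast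
    qed
    then obtain p where "\<And>i. Inv i (p i)" "\<And>i. p (Suc i) \<in> W (p i) (s i)" by blast
    moreover have "p 0 = p0" using calculation(1)[of 0] by (simp add: Inv_def)
    ultimately show ?thesis using range by blast
  qed
  then show ?thesis by (rule that[OF E])
qed

end

section \<open>Stems and runs of the game\<close>

definition precedes :: "nat set \<Rightarrow> nat set \<Rightarrow> bool" where
  "precedes a S \<longleftrightarrow> (\<forall>x\<in>a. \<forall>y\<in>S. x < y)"

lemma precedes_mono: "precedes a S \<Longrightarrow> T \<subseteq> S \<Longrightarrow> precedes a T"
  unfolding precedes_def by blast

lemma above_mono: "A \<subseteq> B \<Longrightarrow> above A n \<subseteq> above B n"
  unfolding above_def by blast

lemma above_Un: "precedes a S \<Longrightarrow> n \<in> a \<Longrightarrow> above (a \<union> S) n = above a n \<union> S"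
  unfolding above_def precedes_def by blast

lemma above_Un': "precedes a S \<Longrightarrow> n \<in> S \<Longrightarrow> above (a \<union> S) n = above S n"
  unfolding above_def precedes_def by fastforce

text \<open>Removing the stem turns a member of \<open>[a,A]\<close> into an infinite set beyond
  \<open>a\<close>. Together with the converse \<open>basic_setI\<close>, this reduces basic sets to
  unions \<open>a \<union> S\<close>.\<close>

lemma basic_setD:
  assumes "finite a" "B \<in> basic_set a A"
  shows "a \<subseteq> A" "infinite (B - a)" "precedes a (B - a)" "a \<union> (B - a) = B" "B \<subseteq> A"
  using assms unfolding basic_set_def init_segment_def precedes_def
  by (auto simp: not_le[symmetric])

lemma basic_setI:
  assumes "precedes a S" "infinite S" "a \<subseteq> A" "S \<subseteq> A"
  shows "a \<union> S \<in> basic_set a A"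
  using assms unfolding basic_set_def init_segment_def precedes_def
  by (auto simp: not_le[symmetric])

text \<open>Each reply set lies strictly above the number just played and the sets decrease, so the
  numbers increase and each lies in all earlier sets. The last two inclusions say what I,
  respectively II, can enforce on the outcome by choosing a set.\<close>

lemma run_of_game:
  assumes I: "\<And>k. legal_I H A As Bs k" and II: "\<And>k. legal_II H a As ns Bs k"
  shows "As (Suc k) \<subseteq> Bs k" "Bs k \<subseteq> above (As k) (ns k)" "ns k \<in> As k"
    and "range ns \<subseteq> As 0" "infinite (range ns)" "precedes a (range ns)"
    and "above (range ns) (ns k) \<subseteq> As (Suc k)"
    and "range ns \<subseteq> insert (ns 0) (Bs 0)"
proof -
  have step: "As (Suc k) \<subseteq> Bs k" for k using I[of "Suc k"] by (simp add: legal_I_def)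
  have reply: "Bs k \<subseteq> above (As k) (ns k)" "ns k \<in> As k" for k
    using II[of k] by (simp_all add: legal_II_def)
  show "As (Suc k) \<subseteq> Bs k" "Bs k \<subseteq> above (As k) (ns k)" "ns k \<in> As k" for k
    using step reply by auto
  have above_sub: "above B n \<subseteq> B" for B n by (auto simp: above_def)
  have dec: "As (Suc k) \<subseteq> As k" for k
    using step[of k] reply(1)[of k] above_sub by blast
  then have anti: "i \<le> j \<Longrightarrow> As j \<subseteq> As i" for i j by (rule lift_Suc_antimono_le)
  have later: "ns j \<in> As (Suc i)" if "i < j" for i j
    using anti[of "Suc i" j] reply(2)[of j] that by auto
  have mono: "ns i < ns j" if "i < j" for i j
    using later[OF that] step[of i] reply(1)[of i] by (auto simp: above_def)
  then have "strict_mono ns" by (simp add: strict_mono_def)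
  then show "infinite (range ns)"
    by (simp add: strict_mono_imp_inj_on range_inj_infinite)
  show "range ns \<subseteq> As 0" using anti[of 0] reply(2) by blast
  have "ns 0 \<le> ns j" for j using mono[of 0 j] by (cases j) auto
  moreover have "\<forall>x\<in>a. x < ns 0" using II[of 0] by (simp add: legal_II_def)
  ultimately show "precedes a (range ns)" by (fastforce simp: precedes_def intro: less_le_trans)
  show "above (range ns) (ns k) \<subseteq> As (Suc k)" for k
  proof
    fix m assume "m \<in> above (range ns) (ns k)"
    then obtain j where j: "m = ns j" "ns k < ns j" by (auto simp: above_def)
    then have "k < j" using mono[of j k] by (metis less_asym less_irrefl linorder_neqE_nat)
    then show "m \<in> As (Suc k)" using later j by simp
  qed
  show "range ns \<subseteq> insert (ns 0) (Bs 0)"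
  proof
    fix m assume "m \<in> range ns"
    then obtain j where "m = ns j" by blast
    then show "m \<in> insert (ns 0) (Bs 0)"
      using later[of 0 j] step[of 0] by (cases j) auto
  qed
qed

section \<open>From winning strategies to homogeneous sets\<close>

context infinitary_coideal
begin

lemma precedes_mem:
  assumes "finite a" "A \<in> H"
  shows "{n\<in>A. \<forall>x\<in>a. x < n} \<in> H"
proof -
  have "A - (\<Union>x\<in>a. {..x}) \<in> H" using Diff_finite_mem[OF assms(2)] assms(1) by simp
  moreover have "A - (\<Union>x\<in>a. {..x}) = {n\<in>A. \<forall>x\<in>a. x < n}" by (auto simp: not_le)
  ultimately show ?thesis by simp
qed

text \<open>The states for \<open>fusion\<close> are II's histories against \<open>\<sigma>\<close>,
  with the next set offered by \<open>\<sigma>\<close>. Density holds because II may answer with any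
  small \<open>B\<close>, which bounds the next move of \<open>\<sigma>\<close>.\<close>

lemma homogeneous_if_winning_I:
  assumes semi: "semiselective H" and a: "finite a" and A: "A \<in> H"
    and win: "winning_strategy_I H a A X \<sigma>"
  obtains E where "E \<in> H" "E \<subseteq> A" "precedes a E"
    "\<And>S. infinite S \<Longrightarrow> S \<subseteq> E \<Longrightarrow> a \<union> S \<in> X"
proof -
  \<comment> \<open>Points not beyond \<open>a\<close> are dropped, so that every element of
    \<open>M p\<close> is a legal choice for II, also in the first round.\<close>
  define M where "M p = {n \<in> \<sigma> p. \<forall>x\<in>a. x < n}" for p
  define W where "W p n = {p @ [(n, B)] |B. n \<in> M p \<and> B \<in> H \<and> B \<subseteq> above (M p) n}" for p n
  define L where "L = {p. \<forall>j<length p. fst (p ! j) \<in> M (take j p) \<and>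
      snd (p ! j) \<in> H \<and> snd (p ! j) \<subseteq> above (M (take j p)) (fst (p ! j))}"
  have legal: "\<sigma> p \<in> H" "p = [] \<Longrightarrow> \<sigma> p \<subseteq> A" "p \<noteq> [] \<Longrightarrow> \<sigma> p \<subseteq> snd (last p)" if p: "p \<in> L" for p
  proof -
    \<comment> \<open>A winning strategy is defined through infinite sequences. Past the end of
      \<open>p\<close> the values of \<open>nth\<close> are arbitrary, while legality of II's moves
      is demanded only before stage \<open>length p\<close>.\<close>
    define ns where "ns i = fst (p ! i)" for i
    define Bs where "Bs i = snd (p ! i)" for i
    let ?As = "\<lambda>k. \<sigma> (map (\<lambda>i. (ns i, Bs i)) [0..<k])"
    have hist: "map (\<lambda>i. (ns i, Bs i)) [0..<j] = take j p" if "j \<le> length p" for j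
      using that by (intro nth_equalityI) (auto simp: ns_def Bs_def)
    have "legal_II H a ?As ns Bs j" if j: "j < length p" for j
    proof -
      have "fst (p ! j) \<in> M (take j p)" "snd (p ! j) \<in> H"
        "snd (p ! j) \<subseteq> above (M (take j p)) (fst (p ! j))"
        using p j by (auto simp: L_def)
      moreover have "above (M (take j p)) n \<subseteq> above (\<sigma> (take j p)) n" for n
        by (rule above_mono) (auto simp: M_def)
      ultimately have "ns j \<in> \<sigma> (take j p)" "\<forall>x\<in>a. x < ns j" "Bs j \<in> H"
        "Bs j \<subseteq> above (\<sigma> (take j p)) (ns j)"
        by (auto simp: ns_def Bs_def M_def)
      then show ?thesis
        using hist[of j] j infinite_mem by (auto simp: legal_II_def)
    qed
    then have "legal_I H A ?As Bs (length p)"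
      using win unfolding winning_strategy_I_def Let_def by blast
    then show "\<sigma> p \<in> H" "p = [] \<Longrightarrow> \<sigma> p \<subseteq> A" "p \<noteq> [] \<Longrightarrow> \<sigma> p \<subseteq> snd (last p)"
      using hist[of "length p"]
      by (auto simp: legal_I_def Bs_def last_conv_nth simp del: upt_Suc split: nat.splits)
  qed
  have M_mem: "M p \<in> H" if "p \<in> L" for p
    unfolding M_def using precedes_mem[OF a legal(1)[OF that]] .
  have WL: "q \<in> L" if p: "p \<in> L" and q: "q \<in> W p n" for p n q
  proof -
    obtain B where "q = p @ [(n, B)]" "n \<in> M p" "B \<in> H" "B \<subseteq> above (M p) n"
      using q unfolding W_def by blast
    then show ?thesis
      using p by (auto simp: L_def nth_append less_Suc_eq)
  qed
  have dense: "\<exists>q\<in>W p n. M q \<subseteq> B"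
    if p: "p \<in> L" and n: "n \<in> M p" and B: "B \<in> H" "B \<subseteq> above (M p) n" for p n B
  proof -
    let ?q = "p @ [(n, B)]"
    have q: "?q \<in> W p n" using n B by (auto simp: W_def)
    have "\<sigma> ?q \<subseteq> B" using legal(3)[OF WL[OF p q]] by simp
    then show ?thesis using q by (intro bexI[of _ ?q]) (auto simp: M_def)
  qed
  obtain E where E: "E \<in> H" "E \<subseteq> M []"
    and runs: "\<And>S. infinite S \<Longrightarrow> S \<subseteq> E \<Longrightarrow>
      \<exists>p s. p 0 = [] \<and> range s = S \<and> (\<forall>i. p (Suc i) \<in> W (p i) (s i))"
    by (rule fusion[OF semi _ M_mem WL dense, of "[]"]) (auto simp: L_def)
  have "a \<union> S \<in> X" if S: "infinite S" "S \<subseteq> E" for S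
  proof -
    obtain p s where p0: "p 0 = []" and s: "range s = S"
      and step: "\<And>i. p (Suc i) \<in> W (p i) (s i)"
      using runs[OF S] by blast
    have "\<forall>i. \<exists>B. p (Suc i) = p i @ [(s i, B)] \<and> s i \<in> M (p i) \<and> B \<in> H \<and> B \<subseteq> above (M (p i)) (s i)"
      using step unfolding W_def by blast
    then obtain Bs where Bs: "\<And>i. p (Suc i) = p i @ [(s i, Bs i)]" "\<And>i. s i \<in> M (p i)"
      "\<And>i. Bs i \<in> H" "\<And>i. Bs i \<subseteq> above (M (p i)) (s i)"
      by metis
    have p: "p k = map (\<lambda>i. (s i, Bs i)) [0..<k]" for k
      by (induction k) (simp_all add: p0 Bs(1))
    let ?As = "\<lambda>k. \<sigma> (map (\<lambda>i. (s i, Bs i)) [0..<k])"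
    have "legal_II H a ?As s Bs k" for k
    proof -
      have "above (M (p k)) (s k) \<subseteq> above (\<sigma> (p k)) (s k)"
        by (rule above_mono) (auto simp: M_def)
      then show ?thesis
        using Bs(2-4)[of k] infinite_mem unfolding p by (auto simp: legal_II_def M_def)
    qed
    then show ?thesis using win s unfolding winning_strategy_I_def Let_def by blast
  qed
  moreover have "E \<subseteq> A" "precedes a E"
    using E(2) legal(2)[of "[]"] by (auto simp: M_def L_def precedes_def)
  ultimately show ?thesis using that E(1) by blast
qed

text \<open>A state is a list of moves of I with a set \<open>E\<close> each \<open>n\<close> of
  which I can extract from \<open>\<tau>\<close> as an answer whose set contains
  \<open>above E n\<close>. Hence every infinite subset of the fused set arises from a run won by
  II.\<close>

lemma homogeneous_if_winning_II:
  assumes semi: "semiselective H" and A: "A \<in> H"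
    and win: "winning_strategy_II H a A X \<tau>"
  obtains E where "E \<in> H" "E \<subseteq> A" "precedes a E"
    "\<And>S. infinite S \<Longrightarrow> S \<subseteq> E \<Longrightarrow> a \<union> S \<notin> X"
proof -
  \<comment> \<open>The set in which I must play next: II's last set, or \<open>A\<close> before the
    first round.\<close>
  define R where "R p = (if p = [] then A else snd (\<tau> p))" for p
  define legal where "legal p \<longleftrightarrow> (\<forall>j<length p. p ! j \<in> H \<and> p ! j \<subseteq> R (take j p))" for p
  have legal_snoc: "legal (p @ [C]) \<longleftrightarrow> legal p \<and> C \<in> H \<and> C \<subseteq> R p" for p C
    unfolding legal_def by (auto simp: nth_append less_Suc_eq)
  have reply: "fst (\<tau> (p @ [C])) \<in> C" "p = [] \<Longrightarrow> \<forall>x\<in>a. x < fst (\<tau> (p @ [C]))"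
    "R (p @ [C]) \<in> H" "R (p @ [C]) \<subseteq> above C (fst (\<tau> (p @ [C])))"
    if "legal (p @ [C])" for p C
  proof -
    define q where "q = p @ [C]"
    define As where "As i = q ! i" for i
    let ?ns = "\<lambda>k. fst (\<tau> (map As [0..<Suc k]))" and ?Bs = "\<lambda>k. snd (\<tau> (map As [0..<Suc k]))"
    have hist: "map As [0..<j] = take j q" if "j \<le> length q" for j
      using that by (intro nth_equalityI) (auto simp: As_def)
    have "legal_I H A As ?Bs j" if j: "j \<le> length p" for j
    proof -
      have "As j \<in> H" "As j \<subseteq> R (take j q)"
        using that \<open>legal (p @ [C])\<close> unfolding legal_def As_def q_def by auto
      then show ?thesis
        using hist[of j] j infinite_mem
        by (cases j) (auto simp: legal_I_def R_def q_def simp del: upt_Suc split: if_splits)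
    qed
    then have "legal_II H a As ?ns ?Bs (length p)"
      using win unfolding winning_strategy_II_def Let_def by blast
    moreover have "map As [0..<Suc (length p)] = p @ [C]" "As (length p) = C"
      using hist[of "Suc (length p)"] by (simp_all add: q_def As_def)
    ultimately show "fst (\<tau> (p @ [C])) \<in> C" "p = [] \<Longrightarrow> \<forall>x\<in>a. x < fst (\<tau> (p @ [C]))"
      "R (p @ [C]) \<in> H" "R (p @ [C]) \<subseteq> above C (fst (\<tau> (p @ [C])))"
      by (auto simp: legal_II_def R_def simp del: upt_Suc)
  qed
  define good where "good p n C \<longleftrightarrow>
      (\<exists>A'\<in>H. A' \<subseteq> R p \<and> fst (\<tau> (p @ [A'])) = n \<and> C \<subseteq> R (p @ [A']))" for p n C
  have good_mono: "good p n C \<Longrightarrow> C' \<subseteq> C \<Longrightarrow> good p n C'" for p n C C'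
    unfolding good_def by blast
  have good_dense: "\<exists>E\<in>H. E \<subseteq> B \<and> (\<forall>n\<in>E. good p n (above E n))"
    if p: "legal p" and B: "B \<in> H" "B \<subseteq> R p" for p B
  proof -
    \<comment> \<open>A set in \<open>D n\<close> is good for \<open>n\<close> or hopeless, in that
      no subset of it in \<open>H\<close> is good.\<close>
    define D where "D n = {C \<in> H. good p n C \<or> (\<forall>C'\<in>H. C' \<subseteq> C \<longrightarrow> \<not> good p n C')}" for n
    have "dense_open H (D n)" for n
    proof (rule dense_openI)
      show "\<exists>C\<in>D n. C \<subseteq> A" if "A \<in> H" for A
        using that by (cases "\<exists>C\<in>H. C \<subseteq> A \<and> good p n C") (auto simp: D_def)
      show "C' \<in> D n" if "C \<in> D n" "C' \<in> H" "C' \<subseteq> C" for C C'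
        using that good_mono by (auto simp: D_def)
    qed (auto simp: D_def)
    then obtain E where E: "E \<in> H" "E \<subseteq> B" and diag: "diagonalization D E"
      using semi B unfolding semiselective_def by blast
    define E1 where "E1 = {n\<in>E. good p n (above E n)}"
    have "E - E1 \<notin> H"
    proof
      assume mem: "E - E1 \<in> H"
      \<comment> \<open>I plays the bad points themselves. The number answered by
        \<open>\<tau>\<close> is bad, yet the set answered is a good subset of the tail of
        \<open>E\<close> after it, so this tail is not hopeless and must be good.\<close>
      let ?q = "p @ [E - E1]" and ?n = "fst (\<tau> (p @ [E - E1]))"
      have q: "legal ?q" using p mem E B by (auto simp: legal_snoc)
      have n: "?n \<in> E - E1" using reply(1)[OF q] .
      have sub: "R ?q \<subseteq> above E ?n"
        using reply(4)[OF q] above_mono[of "E - E1" E] by blast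
      have "good p ?n (R ?q)" using mem q by (auto simp: good_def legal_snoc)
      moreover have "above E ?n \<in> D ?n" using diag n by (auto simp: diagonalization_def)
      ultimately have "good p ?n (above E ?n)"
        using sub reply(3)[OF q] by (auto simp: D_def)
      then show False using n by (simp add: E1_def)
    qed
    then have "E1 \<in> H"
      using Un_mem[of E1 "E - E1"] E(1) by (auto simp: E1_def Un_absorb1)
    moreover have "good p n (above E1 n)" if "n \<in> E1" for n
      using that good_mono[of p n "above E n" "above E1 n"] by (auto simp: E1_def above_def)
    moreover have "E1 \<subseteq> B" using E(2) by (auto simp: E1_def)
    ultimately show ?thesis by blast
  qed
  define L where "L = {(p, E). legal p \<and> E \<in> H \<and> E \<subseteq> R p \<and> (\<forall>n\<in>E. good p n (above E n))}"
  define W where "W x n =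
      {(fst x @ [A'], E') |A' E'. fst (\<tau> (fst x @ [A'])) = n \<and> (fst x @ [A'], E') \<in> L}" for x :: "nat set list \<times> nat set" and n
  have "legal []" by (simp add: legal_def)
  then obtain E0 where E0: "([], E0) \<in> L"
    using good_dense[of "[]" A] A by (auto simp: L_def R_def)
  have dense: "\<exists>y\<in>W x n. snd y \<subseteq> B"
    if x: "x \<in> L" and n: "n \<in> snd x" and B: "B \<in> H" "B \<subseteq> above (snd x) n" for x n B
  proof -
    obtain p E where xp: "x = (p, E)" by (cases x)
    have p: "legal p" and "good p n (above E n)" using x n by (auto simp: L_def xp)
    then obtain A' where A': "A' \<in> H" "A' \<subseteq> R p" "fst (\<tau> (p @ [A'])) = n" "above E n \<subseteq> R (p @ [A'])"
      unfolding good_def by blast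
    have q: "legal (p @ [A'])" using p A' by (simp add: legal_snoc)
    have BR: "B \<subseteq> R (p @ [A'])" using A'(4) B(2) xp by auto
    then obtain E' where E': "E' \<in> H" "E' \<subseteq> B" "\<forall>m\<in>E'. good (p @ [A']) m (above E' m)"
      using good_dense[OF q B(1) BR] by blast
    then have "(p @ [A'], E') \<in> L" using q BR by (auto simp: L_def)
    then have "(p @ [A'], E') \<in> W x n" using A'(3) by (auto simp: W_def xp)
    then show ?thesis using E'(2) by (intro bexI[of _ "(p @ [A'], E')"]) auto
  qed
  obtain E where E: "E \<in> H" "E \<subseteq> E0"
    and runs: "\<And>S. infinite S \<Longrightarrow> S \<subseteq> E \<Longrightarrow>
      \<exists>p s. p 0 = ([], E0) \<and> range s = S \<and> (\<forall>i. p (Suc i) \<in> W (p i) (s i))"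
    by (rule fusion[OF semi E0 _ _ dense]) (auto simp: L_def W_def)
  have "a \<union> S \<notin> X" if S: "infinite S" "S \<subseteq> E" for S
  proof -
    obtain p s where p0: "p 0 = ([], E0)" and s: "range s = S"
      and step: "\<And>i. p (Suc i) \<in> W (p i) (s i)"
      using runs[OF S] by blast
    have "\<exists>A'. fst (p (Suc i)) = fst (p i) @ [A'] \<and>
        fst (\<tau> (fst (p i) @ [A'])) = s i \<and> legal (fst (p i) @ [A'])" for i
      using step[of i] by (auto simp: W_def L_def)
    then obtain As where As: "\<And>i. fst (p (Suc i)) = fst (p i) @ [As i]"
      "\<And>i. fst (\<tau> (fst (p i) @ [As i])) = s i" "\<And>i. legal (fst (p i) @ [As i])"
      by metis
    have p: "fst (p k) = map As [0..<k]" for k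
      by (induction k) (simp_all add: p0 As(1))
    let ?ns = "\<lambda>k. fst (\<tau> (map As [0..<Suc k]))" and ?Bs = "\<lambda>k. snd (\<tau> (map As [0..<Suc k]))"
    have "legal_I H A As ?Bs k" for k
    proof -
      have "As k \<in> H" "As k \<subseteq> R (map As [0..<k])"
        using As(3)[of k] by (simp_all add: legal_snoc p)
      then show ?thesis
        using infinite_mem by (cases k) (auto simp: legal_I_def R_def simp del: upt_Suc)
    qed
    then have "a \<union> range ?ns \<notin> X"
      using win unfolding winning_strategy_II_def Let_def by blast
    moreover have "?ns = s" using As(2) p by auto
    ultimately show ?thesis using s by (simp only: not_False_eq_True)
  qed
  \<comment> \<open>Every element of \<open>E0\<close> is the answer of \<open>\<tau>\<close> to
    some first move, hence exceeds \<open>a\<close>.\<close>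
  moreover have "precedes a E0"
    unfolding precedes_def
  proof (intro ballI)
    fix x n assume "x \<in> a" "n \<in> E0"
    then have "good [] n (above E0 n)" using E0 by (auto simp: L_def)
    then obtain A' where "A' \<in> H" "A' \<subseteq> R []" "fst (\<tau> [A']) = n" by (auto simp: good_def)
    moreover have "legal ([] @ [A'])" using calculation \<open>legal []\<close> by (simp add: legal_snoc del: append_Nil)
    ultimately show "x < n" using reply(2)[of "[]" A'] \<open>x \<in> a\<close> by auto
  qed
  moreover have "E0 \<subseteq> A" using E0 by (auto simp: L_def R_def)
  ultimately show ?thesis using that[OF E(1)] E(2) precedes_mono[of a E0 E] by blast
qed

section \<open>From homogeneous sets to winning strategies\<close>

text \<open>I opens with \<open>E\<close> and then returns II's last set unchanged, so all numbers
  come from \<open>E\<close>.\<close>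

lemma winning_I_if_homogeneous:
  assumes E: "E \<in> H" "E \<subseteq> A"
    and hom: "\<And>S. infinite S \<Longrightarrow> S \<subseteq> E \<Longrightarrow> precedes a S \<Longrightarrow> a \<union> S \<in> X"
  shows "\<exists>\<sigma>. winning_strategy_I H a A X \<sigma>"
proof -
  define \<sigma> where "\<sigma> p = (if p = [] then E else snd (last p))" for p :: "(nat \<times> nat set) list"
  have "winning_strategy_I H a A X \<sigma>"
    unfolding winning_strategy_I_def Let_def
  proof (intro allI conjI impI)
    fix ns :: "nat \<Rightarrow> nat" and Bs
    let ?As = "\<lambda>k. \<sigma> (map (\<lambda>i. (ns i, Bs i)) [0..<k])"
    have As: "?As 0 = E" "\<And>k. ?As (Suc k) = Bs k" by (simp_all add: \<sigma>_def)
    show legal: "legal_I H A ?As Bs k" if "\<forall>j<k. legal_II H a ?As ns Bs j" for k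
    proof (cases k)
      case 0
      then show ?thesis using E by (simp add: legal_I_def As(1) \<sigma>_def)
    next
      case (Suc j)
      then have "legal_II H a ?As ns Bs j" using that by simp
      then show ?thesis using Suc by (simp add: legal_I_def legal_II_def As(2) del: upt_Suc)
    qed
    assume II: "\<forall>k. legal_II H a ?As ns Bs k"
    have I: "legal_I H A ?As Bs k" for k using legal II by blast
    have "range ns \<subseteq> E"
      using run_of_game(4)[of H A ?As Bs a ns, OF I II[rule_format]] by (simp add: \<sigma>_def)
    then show "a \<union> range ns \<in> X"
      using hom run_of_game(5,6)[of H A ?As Bs a ns, OF I II[rule_format]] by blast
  qed
  then show ?thesis by blast
qed

text \<open>II's first reply confines the run to a subset \<open>f (As 0)\<close> of the opening
  move that avoids \<open>X\<close>. From then on II plays the least element of the set offered and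
  keeps the rest.\<close>

lemma winning_II_if_homogeneous:
  assumes a: "finite a"
    and hom: "\<And>A'. A' \<in> H \<Longrightarrow> A' \<subseteq> A \<Longrightarrow> \<exists>E\<in>H. E \<subseteq> A' \<and>
      (\<forall>S. infinite S \<longrightarrow> S \<subseteq> E \<longrightarrow> precedes a S \<longrightarrow> a \<union> S \<notin> X)"
  shows "\<exists>\<tau>. winning_strategy_II H a A X \<tau>"
proof -
  have "\<exists>E\<in>H. E \<subseteq> A' \<and> precedes a E \<and>
      (\<forall>S. infinite S \<longrightarrow> S \<subseteq> E \<longrightarrow> precedes a S \<longrightarrow> a \<union> S \<notin> X)"
    if A': "A' \<in> H" "A' \<subseteq> A" for A'
  proof -
    obtain E where E: "E \<in> H" "E \<subseteq> A'"
      and hE: "\<And>S. infinite S \<Longrightarrow> S \<subseteq> E \<Longrightarrow> precedes a S \<Longrightarrow> a \<union> S \<notin> X"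
      using hom[OF A'] by blast
    \<comment> \<open>Trimming makes the least element a legal first number.\<close>
    let ?E = "{n\<in>E. \<forall>x\<in>a. x < n}"
    have "?E \<in> H" using precedes_mem[OF a E(1)] .
    moreover have "precedes a ?E" "?E \<subseteq> E" by (auto simp: precedes_def)
    ultimately show ?thesis using E(2) hE by (intro bexI[of _ ?E]) auto
  qed
  then obtain f where f: "\<And>A'. A' \<in> H \<Longrightarrow> A' \<subseteq> A \<Longrightarrow> f A' \<in> H \<and> f A' \<subseteq> A' \<and> precedes a (f A') \<and>
      (\<forall>S. infinite S \<longrightarrow> S \<subseteq> f A' \<longrightarrow> precedes a S \<longrightarrow> a \<union> S \<notin> X)"
    by metis
  define g where "g p = (if length p = 1 then f (hd p) else last p)" for p :: "nat set list"
  define \<tau> where "\<tau> p = ((LEAST n. n \<in> g p), above (g p) (LEAST n. n \<in> g p))" for p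
  have "winning_strategy_II H a A X \<tau>"
    unfolding winning_strategy_II_def Let_def
  proof (intro allI conjI impI)
    fix As :: "nat \<Rightarrow> nat set"
    let ?ns = "\<lambda>k. fst (\<tau> (map As [0..<Suc k]))" and ?Bs = "\<lambda>k. snd (\<tau> (map As [0..<Suc k]))"
    define C where "C k = g (map As [0..<Suc k])" for k
    have C: "C 0 = f (As 0)" "\<And>k. C (Suc k) = As (Suc k)" by (simp_all add: C_def g_def)
    have ns: "?ns k = (LEAST n. n \<in> C k)" and Bs: "?Bs k = above (C k) (?ns k)" for k
      by (simp_all add: \<tau>_def C_def del: upt_Suc)
    show legal: "legal_II H a As ?ns ?Bs k" if I: "\<forall>j\<le>k. legal_I H A As ?Bs j" for k
    proof -
      have "As k \<in> H" "As 0 \<in> H" "As 0 \<subseteq> A"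
        using I[rule_format, of k] I[rule_format, of 0] by (simp_all add: legal_I_def)
      then have Ck: "C k \<in> H" "C k \<subseteq> As k" "k = 0 \<longrightarrow> precedes a (C k)"
        using C f by (cases k; auto)+
      then have "C k \<noteq> {}" using infinite_mem by fastforce
      then have "?ns k \<in> C k" unfolding ns by (metis LeastI_ex ex_in_conv)
      moreover have "?Bs k \<in> H" unfolding Bs using above_mem[OF Ck(1)] .
      moreover have "?Bs k \<subseteq> above (As k) (?ns k)" unfolding Bs using above_mono[OF Ck(2)] .
      ultimately show ?thesis
        using Ck infinite_mem by (auto simp: legal_II_def precedes_def simp del: upt_Suc)
    qed
    assume I: "\<forall>k. legal_I H A As ?Bs k"
    have II: "legal_II H a As ?ns ?Bs k" for k using legal I by blast
    note run = run_of_game[of H A As ?Bs a ?ns, OF I[rule_format] II]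
    have A0: "As 0 \<in> H" "As 0 \<subseteq> A" using I[rule_format, of 0] by (auto simp: legal_I_def)
    have "f (As 0) \<noteq> {}" using f[OF A0] infinite_mem by fastforce
    then have "?ns 0 \<in> f (As 0)" unfolding ns C by (metis LeastI_ex ex_in_conv)
    moreover have "?Bs 0 \<subseteq> f (As 0)" unfolding Bs C by (auto simp: above_def)
    ultimately have "insert (?ns 0) (?Bs 0) \<subseteq> f (As 0)" by (rule insert_subsetI)
    with run(8) have "range ?ns \<subseteq> f (As 0)" by (rule order_trans)
    with run(5,6) f[OF A0] show "a \<union> range ?ns \<notin> X" by (simp only: not_False_eq_True simp_thms)
  qed
  then show ?thesis by blast
qed

section \<open>The Ramsey property and determinacy\<close>

text \<open>Whoever wins, there is a homogeneous \<open>E\<close> beyond \<open>a\<close>, and the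
  members of \<open>[a, a \<union> E]\<close> have the form \<open>a \<union> S\<close> with
  \<open>S\<close> an infinite subset of \<open>E\<close>.\<close>

lemma ramsey_for_if_determined:
  assumes semi: "semiselective H"
    and det: "\<And>A a. A \<in> H \<Longrightarrow> finite a \<Longrightarrow> determined H a A X"
  shows "ramsey_for H X"
  unfolding ramsey_for_def
proof (intro allI impI, elim conjE)
  fix a A assume a: "finite a" and A: "A \<in> H" and ne: "basic_set a A \<noteq> {}"
  \<comment> \<open>Needed for \<open>a \<union> E\<close> to stay inside \<open>A\<close>.\<close>
  then have aA: "a \<subseteq> A" using basic_setD(1)[OF a] by blast
  obtain E where E: "E \<in> H" "E \<subseteq> A" "precedes a E"
    and hom: "(\<forall>S. infinite S \<longrightarrow> S \<subseteq> E \<longrightarrow> a \<union> S \<in> X) \<or> (\<forall>S. infinite S \<longrightarrow> S \<subseteq> E \<longrightarrow> a \<union> S \<notin> X)"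
    using det[OF A a] unfolding determined_def
  proof (elim disjE exE)
    fix \<sigma> assume "winning_strategy_I H a A X \<sigma>"
    from homogeneous_if_winning_I[OF semi a A this] show ?thesis using that by metis
  next
    fix \<tau> assume "winning_strategy_II H a A X \<tau>"
    from homogeneous_if_winning_II[OF semi A this] show ?thesis using that by metis
  qed
  have mem: "a \<union> E \<in> basic_set a A" "a \<union> E \<in> H"
    using basic_setI[OF E(3) infinite_mem[OF E(1)] aA E(2)] upward[OF E(1), of "a \<union> E"] by auto
  have "\<exists>S. infinite S \<and> S \<subseteq> E \<and> B = a \<union> S" if "B \<in> basic_set a (a \<union> E)" for B
    using basic_setD[OF a that] by (intro exI[of _ "B - a"]) auto
  then have "basic_set a (a \<union> E) \<subseteq> X \<or> basic_set a (a \<union> E) \<inter> X = {}"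
    using hom by blast
  then show "\<exists>B\<in>basic_set a A \<inter> H. basic_set a B \<subseteq> X \<or> basic_set a B \<inter> X = {}"
    using mem by blast
qed

text \<open>Either some subset of \<open>A\<close> in \<open>H\<close> is homogeneous with outcomes
  in \<open>X\<close>, and I plays it, or every member of \<open>H\<close> below \<open>A\<close>
  contains one with outcomes outside \<open>X\<close>, and II uses these.\<close>

lemma determined_if_ramsey_for:
  assumes ramsey: "ramsey_for H X" and A: "A \<in> H" and a: "finite a"
  shows "determined H a A X"
proof -
  have *: "\<exists>E\<in>H. E \<subseteq> A' \<and> ((\<forall>S. infinite S \<longrightarrow> S \<subseteq> E \<longrightarrow> precedes a S \<longrightarrow> a \<union> S \<in> X) \<or>
      (\<forall>S. infinite S \<longrightarrow> S \<subseteq> E \<longrightarrow> precedes a S \<longrightarrow> a \<union> S \<notin> X))" if A': "A' \<in> H" for A'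
  proof -
    \<comment> \<open>The Ramsey property is applied to \<open>a \<union> ?A\<close>, because
      \<open>[a,A']\<close> may be empty.\<close>
    let ?A = "{n\<in>A'. \<forall>x\<in>a. x < n}"
    have AH: "?A \<in> H" using precedes_mem[OF a A'] .
    have "precedes a ?A" by (auto simp: precedes_def)
    then have "a \<union> ?A \<in> basic_set a (a \<union> ?A)"
      using infinite_mem[OF AH] by (intro basic_setI) auto
    moreover have "a \<union> ?A \<in> H" using upward[OF AH] by blast
    ultimately obtain B where B: "B \<in> basic_set a (a \<union> ?A)" "B \<in> H"
      and hB: "basic_set a B \<subseteq> X \<or> basic_set a B \<inter> X = {}"
      using ramsey a unfolding ramsey_for_def by blast
    have aB: "a \<subseteq> B" "B \<subseteq> a \<union> ?A" using B(1) by (auto simp: basic_set_def init_segment_def)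
    have "a \<union> S \<in> basic_set a B" if "infinite S" "S \<subseteq> B - a" "precedes a S" for S
      using that aB by (intro basic_setI) auto
    moreover have "B - a \<in> H" using Diff_finite_mem[OF B(2) a] .
    moreover have "B - a \<subseteq> A'" using aB by blast
    ultimately show ?thesis using hB by (intro bexI[of _ "B - a"]) blast+
  qed
  show ?thesis
  proof (cases "\<exists>E\<in>H. E \<subseteq> A \<and> (\<forall>S. infinite S \<longrightarrow> S \<subseteq> E \<longrightarrow> precedes a S \<longrightarrow> a \<union> S \<in> X)")
    case True
    then show ?thesis
      using winning_I_if_homogeneous unfolding determined_def by metis
  next
    case False
    then have "\<exists>E\<in>H. E \<subseteq> A' \<and> (\<forall>S. infinite S \<longrightarrow> S \<subseteq> E \<longrightarrow> precedes a S \<longrightarrow> a \<union> S \<notin> X)"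
      if "A' \<in> H" "A' \<subseteq> A" for A'
      using *[OF that(1)] that(2) by (meson order_trans)
    then show ?thesis
      using winning_II_if_homogeneous[OF a] unfolding determined_def by metis
  qed
qed

section \<open>From determinacy to semiselectivity\<close>

text \<open>The set of all \<open>B\<close> with \<open>B/n \<in> P n\<close> for every \<open>n \<in> B\<close> gives determined games: player I can
  enforce membership in \<open>P n\<close> right after each move \<open>n\<close> of II. Only the elements of the
  stem \<open>a\<close> could spoil this, whence the last assumption on \<open>P\<close>.\<close>

lemma diagonalization_if_determined_imp_ramsey:
  assumes ramsey: "\<And>X. X \<subseteq> {A. infinite A} \<Longrightarrow>
      (\<And>A a. A \<in> H \<Longrightarrow> finite a \<Longrightarrow> determined H a A X) \<Longrightarrow> ramsey_for H X"
    and hereditary: "\<And>n B C. B \<in> P n \<Longrightarrow> C \<subseteq> B \<Longrightarrow> C \<in> P n"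
    and dense: "\<And>n A. A \<in> H \<Longrightarrow> \<exists>B\<in>H. B \<subseteq> A \<and> B \<in> P n"
    and stem: "\<And>n s. finite s \<Longrightarrow>
      (\<forall>S. s \<union> S \<notin> P n) \<or> (\<forall>A\<in>H. \<exists>B\<in>H. B \<subseteq> A \<and> s \<union> B \<in> P n)"
    and A: "A \<in> H"
  shows "\<exists>B\<in>H. B \<subseteq> A \<and> (\<forall>n\<in>B. above B n \<in> P n)"
proof -
  define X where "X = {B. infinite B \<and> (\<forall>n\<in>B. above B n \<in> P n)}"
  \<comment> \<open>The move with which I forces \<open>P n\<close> after II has played
    \<open>n\<close> and \<open>C\<close>.\<close>
  define g where "g n C = (SOME B. B \<in> H \<and> B \<subseteq> C \<and> B \<in> P n)" for n C
  have g: "g n C \<in> H" "g n C \<subseteq> C" "g n C \<in> P n" if "C \<in> H" for n C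
    using someI_ex[of "\<lambda>B. B \<in> H \<and> B \<subseteq> C \<and> B \<in> P n"] dense[OF that] unfolding g_def by blast+
  have "determined H a A X" if A: "A \<in> H" and a: "finite a" for A a
  \<comment> \<open>If a point of the stem fails for every continuation, no outcome lies in
    \<open>X\<close> and II wins. Otherwise the assumption \<open>stem\<close> provides an opening
    move for I.\<close>
  proof (cases "\<exists>n\<in>a. \<forall>S. above a n \<union> S \<notin> P n")
    case True
    then obtain n where n: "n \<in> a" "\<And>S. above a n \<union> S \<notin> P n" by blast
    have "a \<union> S \<notin> X" if "precedes a S" for S
    proof
      assume "a \<union> S \<in> X"
      then have "above (a \<union> S) n \<in> P n" using n(1) by (simp add: X_def)
      then show False using n(2) above_Un[OF that n(1)] by simp
    qed
    then show ?thesis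
      using winning_II_if_homogeneous[OF a, of A X] unfolding determined_def by blast
  next
    case False
    \<comment> \<open>The points of \<open>a\<close> are treated one at a time,
      \<open>hereditary\<close> preserving what was achieved. The induction runs over
      \<open>b\<close>, while the stems \<open>above a n\<close> refer to all of
      \<open>a\<close>.\<close>
    have "\<exists>A0\<in>H. A0 \<subseteq> A \<and> (\<forall>n\<in>b. above a n \<union> A0 \<in> P n)" if "b \<subseteq> a" for b
      using finite_subset[OF that a] that
    proof (induction b rule: finite_induct)
      case empty
      then show ?case using A by blast
    next
      case (insert m b)
      then obtain A0 where A0: "A0 \<in> H" "A0 \<subseteq> A" "\<forall>n\<in>b. above a n \<union> A0 \<in> P n" by blast
      have "finite (above a m)" using a by (simp add: above_def)
      then obtain B where B: "B \<in> H" "B \<subseteq> A0" "above a m \<union> B \<in> P m"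
        using stem[of "above a m" m] False insert.prems A0(1) by blast
      have "above a n \<union> B \<in> P n" if "n \<in> b" for n
        using hereditary[of "above a n \<union> A0" n "above a n \<union> B"] A0(3) B(2) that by blast
      then show ?case using A0 B by (intro bexI[of _ B]) auto
    qed
    from this[OF order_refl] obtain A0
      where A0: "A0 \<in> H" "A0 \<subseteq> A" and stem_A0: "\<forall>n\<in>a. above a n \<union> A0 \<in> P n" by blast
    define \<sigma> where "\<sigma> p = (if p = [] then A0 else g (fst (last p)) (snd (last p)))"
      for p :: "(nat \<times> nat set) list"
    have "winning_strategy_I H a A X \<sigma>"
      unfolding winning_strategy_I_def Let_def
    proof (intro allI conjI impI)
      fix ns :: "nat \<Rightarrow> nat" and Bs
      let ?As = "\<lambda>k. \<sigma> (map (\<lambda>i. (ns i, Bs i)) [0..<k])"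
      have As: "?As (Suc k) = g (ns k) (Bs k)" for k by (simp add: \<sigma>_def)
      show legal: "legal_I H A ?As Bs k" if "\<forall>j<k. legal_II H a ?As ns Bs j" for k
      proof (cases k)
        case 0
        then show ?thesis using A0 by (simp add: legal_I_def \<sigma>_def)
      next
        case (Suc j)
        then have "legal_II H a ?As ns Bs j" using that by simp
        then have "Bs j \<in> H" by (simp add: legal_II_def)
        then show ?thesis
          using Suc g infinite_mem by (simp add: legal_I_def As del: upt_Suc)
      qed
      assume II: "\<forall>k. legal_II H a ?As ns Bs k"
      have I: "legal_I H A ?As Bs k" for k using legal II by blast
      note run = run_of_game[of H A ?As Bs a ns, OF I II[rule_format]]
      let ?S = "range ns"
      have "above (a \<union> ?S) n \<in> P n" if "n \<in> a \<union> ?S" for n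
        using that
      proof
        assume n: "n \<in> a"
        have "?S \<subseteq> A0" using run(4) by (simp add: \<sigma>_def)
        then show ?thesis
          using above_Un[OF run(6) n] hereditary[OF stem_A0[rule_format, OF n], of "above a n \<union> ?S"] by auto
      next
        assume n: "n \<in> ?S"
        then obtain k where k: "n = ns k" by blast
        have "Bs k \<in> H" using II by (simp add: legal_II_def)
        then have "?As (Suc k) \<in> P n" unfolding As k by (rule g(3))
        then show ?thesis
          using above_Un'[OF run(6) n] run(7)[of k] hereditary k by metis
      qed
      then show "a \<union> ?S \<in> X" using run(5) by (simp add: X_def)
    qed
    then show ?thesis unfolding determined_def by blast
  qed
  then have "ramsey_for H X" by (intro ramsey) (auto simp: X_def)
  moreover have "basic_set {} A \<noteq> {}"
    using infinite_mem[OF A] by (auto simp: basic_set_def init_segment_def)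
  ultimately have "\<exists>B\<in>basic_set {} A \<inter> H. basic_set {} B \<subseteq> X \<or> basic_set {} B \<inter> X = {}"
    using A unfolding ramsey_for_def by simp
  then obtain B where B: "B \<in> H" "B \<subseteq> A"
    and hB: "basic_set {} B \<subseteq> X \<or> basic_set {} B \<inter> X = {}"
    by (auto simp: basic_set_def)
  have basic: "S \<in> basic_set {} B" if "infinite S" "S \<subseteq> B" for S
    using that by (simp add: basic_set_def init_segment_def)
  \<comment> \<open>To exclude that \<open>[{}, B]\<close> misses \<open>X\<close>, an element of
    \<open>X\<close> inside \<open>B\<close> is built from the least points of a decreasing sequence
    in \<open>H\<close>. It must be infinite but may lie outside \<open>H\<close>.\<close>
  have "\<exists>C. \<forall>k. (C k \<in> H \<and> C k \<subseteq> B) \<and>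
      (C (Suc k) \<subseteq> above (C k) (LEAST n. n \<in> C k) \<and> C (Suc k) \<in> P (LEAST n. n \<in> C k))"
  proof (rule dependent_nat_choice)
    show "\<exists>C. C \<in> H \<and> C \<subseteq> B" using B by blast
  next
    fix C and k :: nat assume C: "C \<in> H \<and> C \<subseteq> B"
    let ?n = "LEAST n. n \<in> C"
    have "above C ?n \<in> H" using above_mem C by blast
    from dense[OF this, of ?n] obtain D where D: "D \<in> H" "D \<subseteq> above C ?n" "D \<in> P ?n" by blast
    moreover have "D \<subseteq> B" using D(2) C by (auto simp: above_def)
    ultimately show "\<exists>D. (D \<in> H \<and> D \<subseteq> B) \<and> D \<subseteq> above C ?n \<and> D \<in> P ?n" by blast
  qed
  then obtain C where C: "\<And>k. C k \<in> H" "\<And>k. C k \<subseteq> B"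
    and next_C: "\<And>k. C (Suc k) \<subseteq> above (C k) (LEAST n. n \<in> C k)"
      "\<And>k. C (Suc k) \<in> P (LEAST n. n \<in> C k)"
    by blast
  define s where "s k = (LEAST n. n \<in> C k)" for k
  have sC: "s k \<in> C k" for k
    unfolding s_def using infinite_mem[OF C(1)[of k]] by (metis LeastI_ex ex_in_conv finite.emptyI)
  \<comment> \<open>The sequence is read as a run with empty stem in which II always takes the least
    element, so that \<open>run_of_game\<close> applies.\<close>
  have I: "legal_I H B C (\<lambda>k. above (C k) (s k)) k" for k
    using C next_C(1) infinite_mem by (cases k) (auto simp: legal_I_def s_def)
  have II: "legal_II H {} C s (\<lambda>k. above (C k) (s k)) k" for k
    using sC above_mem[OF C(1)] infinite_mem by (auto simp: legal_II_def)
  note run = run_of_game[OF I II]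
  have "above (range s) n \<in> P n" if n: "n \<in> range s" for n
  proof -
    obtain k where k: "n = s k" using n by blast
    have "C (Suc k) \<in> P n" using next_C(2)[of k] by (simp add: k s_def)
    then show ?thesis using run(7)[of k] hereditary k by metis
  qed
  then have "range s \<in> X" using run(5) by (simp add: X_def)
  moreover have "range s \<subseteq> B" using run(4) C(2)[of 0] by blast
  ultimately have "basic_set {} B \<subseteq> X" using hB basic[of "range s"] run(5) by blast
  \<comment> \<open>\<open>B\<close> itself belongs to \<open>[{}, B]\<close>.\<close>
  then have "B \<in> X" using basic infinite_mem[OF B(1)] by blast
  then show ?thesis using B by (auto simp: X_def)
qed

text \<open>The previous lemma does not apply to the given dense open sets directly, because finite
  changes of a set matter to them. A first application diagonalizes them modulo finite sets;
  a second one thins out the result so that each of its points exceeds the finitely many errors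
  belonging to its predecessor.\<close>

lemma semiselective_if_determined_imp_ramsey:
  assumes ramsey: "\<And>X. X \<subseteq> {A. infinite A} \<Longrightarrow>
      (\<And>A a. A \<in> H \<Longrightarrow> finite a \<Longrightarrow> determined H a A X) \<Longrightarrow> ramsey_for H X"
  shows "semiselective H"
  unfolding semiselective_def
proof (intro allI impI ballI)
  fix D :: "nat \<Rightarrow> nat set set" and A assume D: "\<forall>n. dense_open H (D n)" and A: "A \<in> H"
  \<comment> \<open>Inclusion modulo a finite set makes \<open>P n\<close> closed under all subsets
    and insensitive to finite stems, whereas \<open>D n\<close> is closed only under subsets in
    \<open>H\<close>.\<close>
  define P where "P n = {B. \<exists>E\<in>D n. finite (B - E)}" for n :: nat
  have sub: "\<exists>E\<in>D n. E \<in> H \<and> E \<subseteq> A" if "A \<in> H" for A n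
    using dense_openD(1,2)[OF D[rule_format, of n]] that by blast
  have "\<exists>B\<in>H. B \<subseteq> A \<and> (\<forall>n\<in>B. above B n \<in> P n)"
  proof (rule diagonalization_if_determined_imp_ramsey[OF ramsey _ _ _ A])
    show "C \<in> P n" if B: "B \<in> P n" and C: "C \<subseteq> B" for n B C
    proof -
      obtain E where E: "E \<in> D n" "finite (B - E)" using B by (auto simp: P_def)
      have "finite (C - E)" using E(2) C by (rule_tac finite_subset) auto
      then show ?thesis using E(1) by (auto simp: P_def)
    qed
    show "\<exists>B\<in>H. B \<subseteq> A \<and> B \<in> P n" if A: "A \<in> H" for n A
    proof -
      obtain E where E: "E \<in> D n" "E \<in> H" "E \<subseteq> A" using sub[OF A] by blast
      then have "E \<in> P n" unfolding P_def by (intro CollectI bexI[of _ E]) auto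
      then show ?thesis using E by blast
    qed
    show "(\<forall>S. s \<union> S \<notin> P n) \<or> (\<forall>A\<in>H. \<exists>B\<in>H. B \<subseteq> A \<and> s \<union> B \<in> P n)"
      if s: "finite s" for n s
    proof (intro disjI2 ballI)
      fix A assume "A \<in> H"
      then obtain E where E: "E \<in> D n" "E \<in> H" "E \<subseteq> A" using sub by blast
      have "s \<union> E - E \<subseteq> s" by auto
      then have "finite (s \<union> E - E)" using s by (rule finite_subset)
      then have "s \<union> E \<in> P n" using E(1) unfolding P_def by blast
      then show "\<exists>B\<in>H. B \<subseteq> A \<and> s \<union> B \<in> P n" using E by blast
    qed
  qed
  then obtain B where B: "B \<in> H" "B \<subseteq> A" "\<And>n. n \<in> B \<Longrightarrow> above B n \<in> P n" by blast
  \<comment> \<open>\<open>f\<close> bounds the finitely many points of \<open>above B n\<close>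
    outside \<open>E\<close>.\<close>
  have "\<exists>E f. E \<in> D n \<and> (\<forall>m\<in>above B n. f < m \<longrightarrow> m \<in> E)" if n: "n \<in> B" for n
  proof -
    obtain E where E: "E \<in> D n" "finite (above B n - E)" using B(3)[OF n] by (auto simp: P_def)
    then obtain f where "\<forall>m\<in>above B n - E. m \<le> f"
      using finite_nat_set_iff_bounded_le by blast
    then show ?thesis using E(1) by (metis DiffI not_le)
  qed
  then obtain E f where E: "\<And>n. n \<in> B \<Longrightarrow> E n \<in> D n"
    and f: "\<And>n m. n \<in> B \<Longrightarrow> m \<in> above B n \<Longrightarrow> f n < m \<Longrightarrow> m \<in> E n"
    by metis
  have "\<exists>C\<in>H. C \<subseteq> B \<and> (\<forall>n\<in>C. above C n \<in> {C. \<forall>m\<in>C. f n < m})"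
  proof (rule diagonalization_if_determined_imp_ramsey[OF ramsey _ _ _ B(1)])
    have beyond: "\<exists>B\<in>H. B \<subseteq> A \<and> B \<in> {C. \<forall>m\<in>C. f n < m}" if "A \<in> H" for n A
      using above_mem[OF that, of "f n"] by (intro bexI[of _ "above A (f n)"]) (auto simp: above_def)
    then show "\<exists>B\<in>H. B \<subseteq> A \<and> B \<in> {C. \<forall>m\<in>C. f n < m}" if "A \<in> H" for n A
      using that by blast
    show "(\<forall>S. s \<union> S \<notin> {C. \<forall>m\<in>C. f n < m}) \<or>
        (\<forall>A\<in>H. \<exists>B\<in>H. B \<subseteq> A \<and> s \<union> B \<in> {C. \<forall>m\<in>C. f n < m})" for n s
    \<comment> \<open>A stem point at or below \<open>f n\<close> spoils every extension; this is
      the first alternative of \<open>stem\<close>.\<close>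
    proof (cases "\<forall>m\<in>s. f n < m")
      case True
      have "\<exists>B\<in>H. B \<subseteq> A \<and> s \<union> B \<in> {C. \<forall>m\<in>C. f n < m}" if A: "A \<in> H" for A
      proof -
        obtain B where "B \<in> H" "B \<subseteq> A" "\<forall>m\<in>B. f n < m" using beyond[OF A, of n] by blast
        then show ?thesis using True by (intro bexI[of _ B]) auto
      qed
      then show ?thesis by simp
    next
      case False
      then show ?thesis by auto
    qed
  qed auto
  then obtain C where C: "C \<in> H" "C \<subseteq> B" "\<And>n m. n \<in> C \<Longrightarrow> m \<in> above C n \<Longrightarrow> f n < m" by blast
  have "above C n \<in> D n" if n: "n \<in> C" for n
  proof -
    have nB: "n \<in> B" using n C(2) by blast
    \<comment> \<open>Points of \<open>C\<close> after \<open>n\<close> exceed \<open>f n\<close>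
      and so avoid the errors; openness of \<open>D n\<close> then applies to the tail, which is in
      \<open>H\<close>.\<close>
    have "above C n \<subseteq> E n"
      using f[OF nB] C(3)[OF n] above_mono[OF C(2), of n] by blast
    then show ?thesis
      using dense_openD(3)[OF D[rule_format] E[OF nB] above_mem[OF C(1)]] by blast
  qed
  then show "\<exists>B\<in>H. B \<subseteq> A \<and> diagonalization D B"
    using C B(2) unfolding diagonalization_def by (intro bexI[of _ C]) auto
qed

end

theorem theorem3p3:
  fixes H :: "nat set set"
  assumes "coideal H"
    and "\<forall>A\<in>H. infinite A"
  shows "semiselective H \<longleftrightarrow>
    (\<forall>X \<subseteq> {A. infinite A}.
       ramsey_for H X \<longleftrightarrow> (\<forall>A\<in>H. \<forall>a. finite a \<longrightarrow> determined H a A X))"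
proof -
  interpret infinitary_coideal H
    using assms by unfold_locales auto
  show ?thesis
  proof
    assume semi: "semiselective H"
    show "\<forall>X \<subseteq> {A. infinite A}.
       ramsey_for H X \<longleftrightarrow> (\<forall>A\<in>H. \<forall>a. finite a \<longrightarrow> determined H a A X)"
      using ramsey_for_if_determined[OF semi] determined_if_ramsey_for by meson
  next
    assume "\<forall>X \<subseteq> {A. infinite A}.
       ramsey_for H X \<longleftrightarrow> (\<forall>A\<in>H. \<forall>a. finite a \<longrightarrow> determined H a A X)"
    then have "ramsey_for H X"
      if "X \<subseteq> {A. infinite A}" "\<And>A a. A \<in> H \<Longrightarrow> finite a \<Longrightarrow> determined H a A X" for X
      using that by simp
    then show "semiselective H" by (rule semiselective_if_determined_imp_ramsey)
  qed
qed

end
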